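(* If $\underline k=(k_1,\dots,k_n)\in(\mathbb Z\setminus\{0\})^n$ is $\mathbb R$-admissible, then $$\sum_{j=1}^n\kappa_jk_j=0$$ for suitable $\kappa_j\in\{1,-1\}$, $j=1,\dots,n$.
   Context: For $\underline k=(k_1,\dots,k_n)\in\mathbb Z^n$ and $z\in U(1)=\{z\in\mathbb C\mid|z|=1\}$ let $z^{\underline k}$ be the diagonal matrix $\mathrm{diag}(z^{k_1},\dots,z^{k_n})$ acting on $\mathbb C^n$. A real subspace $V\subset\mathbb C^n$ is called $\underline k$-good if $\dim_{\mathbb R}V=n$ and $z^{\underline k}V\cap\mathbb R^n=\{0\}$ for all $z\in U(1)$. An $n$-tuple $\underline k\in(\mathbb Z\setminus\{0\})^n$ is called $\mathbb R$-admissible if there exists a $\underline k$-good subspace of $\mathbb C^n$. *)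

theory Defs
  imports "HOL-Analysis.Analysis"
begin

text \<open>Complex \<open>n\<close>-space is \<^typ>\<open>complex ^ 'n\<close> with \<open>n = CARD('n)\<close>. On this type \<^const>\<open>subspace\<close>
  and \<^const>\<open>dim\<close> refer to the underlying real vector space, which is what is wanted below.\<close>

definition diag_pow :: "complex \<Rightarrow> int ^ 'n \<Rightarrow> complex ^ 'n ^ 'n" where
  "diag_pow z k = (\<chi> i j. if i = j then z powi (k $ i) else 0)"

definition real_points :: "(complex ^ 'n) set" where
  "real_points = {x. \<forall>i. x $ i \<in> \<real>}"

definition good_subspace :: "int ^ 'n \<Rightarrow> (complex ^ 'n) set \<Rightarrow> bool" where
  "good_subspace k V \<longleftrightarrow>
     subspace V \<and> dim V = CARD('n) \<and>
     (\<forall>z. norm z = 1 \<longrightarrow> (\<lambda>v. diag_pow z k *v v) ` V \<inter> real_points = {0})"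

definition R_admissible :: "int ^ 'n \<Rightarrow> bool" where
  "R_admissible k \<longleftrightarrow> (\<forall>j. k $ j \<noteq> 0) \<and> (\<exists>V. good_subspace k V)"

end

theory Submission
  imports Defs
begin

text \<open>
  Choose a real basis \<open>b\<^sub>1, \<dots>, b\<^sub>n\<close> of a good subspace and let \<open>A(t)\<close> be the real matrix of
  imaginary parts of the coordinates of \<open>z\<^sup>k b\<^sub>j\<close> for \<open>z = exp(it)\<close>. Goodness says that
  \<open>det A(t)\<close> never vanishes, so it has constant sign. On the other hand each row of \<open>A(t)\<close> has
  the form \<open>(z\<^sup>m u - z\<^sup>-\<^sup>m cnj u) / 2i\<close> with \<open>m\<close> the corresponding entry of \<open>k\<close>, so \<open>det A(t)\<close> is a
  Laurent polynomial in \<open>z\<close> whose exponents are signed sums of the entries of \<open>k\<close>. If none of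
  these is \<open>0\<close>, the average over the \<open>N\<close>-th roots of unity vanishes for large \<open>N\<close>,
  contradicting constancy of sign.
\<close>

text \<open>This is a geometric sum whose ratio \<open>q\<close> is an \<open>N\<close>-th root of
  unity. The bounds on \<open>s\<close> rule out that \<open>N\<close> divides \<open>s\<close>, so
  \<open>q\<close> differs from 1.\<close>

lemma sum_cis_roots_of_unity_eq_0:
  fixes s :: int and N :: nat
  assumes "s \<noteq> 0" "\<bar>s\<bar> < int N"
  shows "(\<Sum>m<N. cis (of_int s * (2 * pi * real m / real N))) = 0"
proof -
  have N: "N > 0" using assms by linarith
  define q where "q = cis (2 * pi * of_int s / real N)"
  have "q \<noteq> 1"
  proof
    assume "q = 1"
    then have "cos (2 * pi * of_int s / real N) = 1"
      by (simp add: q_def complex_eq_iff)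
    then obtain l :: int where "2 * pi * of_int s / real N = of_int l * 2 * pi"
      using cos_one_2pi_int by blast
    then have "of_int s = (of_int l * real N :: real)"
      using N by (simp add: field_simps)
    then have "s = l * int N"
      by (metis of_int_eq_iff of_int_mult of_int_of_nat_eq)
    then have "int N dvd s" by simp
    then show False using assms zdvd_not_zless[of "\<bar>s\<bar>" "int N"] by simp
  qed
  have q_power: "q ^ m = cis (of_int s * (2 * pi * real m / real N))" for m
    unfolding q_def Complex.DeMoivre by (rule arg_cong[where f = cis]) simp
  have "q ^ N = 1"
    using N cis_multiple_2pi[of "of_int s"] by (simp add: q_power mult.commute)
  with \<open>q \<noteq> 1\<close> have "(\<Sum>m<N. q ^ m) = 0"
    by (simp add: geometric_sum)
  then show ?thesis
    by (simp only: q_power)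
qed

lemma prod_cis:
  fixes f :: "'a \<Rightarrow> real"
  shows "(\<Prod>i\<in>A. cis (f i)) = cis (\<Sum>i\<in>A. f i)"
  by (induction A rule: infinite_finite_induct) (auto simp: cis_mult)

text \<open>Expand the product after writing each factor as Im u = (u - cnj u) / 2i. Every resulting
  term is a constant times a power of a root of unity, with a signed sum of the \<open>k i\<close>
  as exponent. This exponent is nonzero and smaller than \<open>N\<close> in absolute value, so each
  term averages to 0.\<close>

lemma sum_prod_Im_cis_eq_0:
  fixes k :: "'a \<Rightarrow> int" and w :: "'a \<Rightarrow> complex"
  assumes I: "finite I"
    and nz: "\<And>B. B \<subseteq> I \<Longrightarrow> sum k B - sum k (I - B) \<noteq> 0"
    and N: "(\<Sum>i\<in>I. \<bar>k i\<bar>) < int N"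
  shows "(\<Sum>m<N. \<Prod>i\<in>I. Im (cis (of_int (k i) * (2 * pi * real m / real N)) * w i)) = 0"
    (is "?S = 0")
proof -
  define \<theta> where "\<theta> m = 2 * pi * real m / real N" for m
  \<comment> \<open>\<open>B\<close> collects the factors from which the u-part is chosen; the other
    factors contribute the conjugate part, with the opposite frequency.\<close>
  define c where "c B = (\<Prod>i\<in>B. w i / (2 * \<i>)) * (\<Prod>i\<in>I - B. - cnj (w i) / (2 * \<i>))" for B
  have expand: "complex_of_real (\<Prod>i\<in>I. Im (cis (of_int (k i) * \<theta> m) * w i)) =
      (\<Sum>B\<in>Pow I. c B * cis (of_int (sum k B - sum k (I - B)) * \<theta> m))" for m
  proof -
    have Im_eq: "complex_of_real (Im (cis (of_int (k i) * \<theta> m) * w i)) =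
        cis (of_int (k i) * \<theta> m) * (w i / (2 * \<i>)) +
        cis (- of_int (k i) * \<theta> m) * (- cnj (w i) / (2 * \<i>))" for i
      using complex_diff_cnj[of "cis (of_int (k i) * \<theta> m) * w i"]
      by (simp add: cis_cnj field_simps)
    have "complex_of_real (\<Prod>i\<in>I. Im (cis (of_int (k i) * \<theta> m) * w i)) =
      (\<Sum>B\<in>Pow I. (\<Prod>i\<in>B. cis (of_int (k i) * \<theta> m) * (w i / (2 * \<i>))) *
         (\<Prod>i\<in>I - B. cis (- of_int (k i) * \<theta> m) * (- cnj (w i) / (2 * \<i>))))"
      unfolding of_real_prod Im_eq by (rule prod_add[OF I])
    also have "\<dots> = (\<Sum>B\<in>Pow I. c B * cis (of_int (sum k B - sum k (I - B)) * \<theta> m))"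
    proof (rule sum.cong[OF refl])
      fix B
      have cis_eq: "cis (\<Sum>i\<in>B. of_int (k i) * \<theta> m) * cis (\<Sum>i\<in>I - B. - of_int (k i) * \<theta> m) =
          cis (of_int (sum k B - sum k (I - B)) * \<theta> m)"
        unfolding cis_mult
        by (simp add: sum_distrib_right left_diff_distrib sum_negf)
      show "(\<Prod>i\<in>B. cis (of_int (k i) * \<theta> m) * (w i / (2 * \<i>))) *
          (\<Prod>i\<in>I - B. cis (- of_int (k i) * \<theta> m) * (- cnj (w i) / (2 * \<i>))) =
          c B * cis (of_int (sum k B - sum k (I - B)) * \<theta> m)"
        unfolding prod.distrib prod_cis c_def cis_eq[symmetric] by (simp only: mult_ac)
    qed
    finally show ?thesis .
  qed
  have "complex_of_real ?S =
      (\<Sum>m<N. \<Sum>B\<in>Pow I. c B * cis (of_int (sum k B - sum k (I - B)) * \<theta> m))"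
    unfolding of_real_sum \<theta>_def[symmetric] expand ..
  also have "\<dots> = (\<Sum>B\<in>Pow I. c B * (\<Sum>m<N. cis (of_int (sum k B - sum k (I - B)) * \<theta> m)))"
    by (subst sum.swap) (simp add: sum_distrib_left)
  also have "\<dots> = 0"
  proof (intro sum.neutral ballI)
    fix B assume "B \<in> Pow I"
    then have B: "B \<subseteq> I" by simp
    have "\<bar>sum k B - sum k (I - B)\<bar> \<le> \<bar>sum k B\<bar> + \<bar>sum k (I - B)\<bar>" by simp
    also have "\<dots> \<le> (\<Sum>i\<in>B. \<bar>k i\<bar>) + (\<Sum>i\<in>I - B. \<bar>k i\<bar>)"
      by (intro add_mono sum_abs)
    also have "\<dots> = (\<Sum>i\<in>I. \<bar>k i\<bar>)"
      using sum.subset_diff[OF B I, of "\<lambda>i. \<bar>k i\<bar>"] by simp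
    finally show "c B * (\<Sum>m<N. cis (of_int (sum k B - sum k (I - B)) * \<theta> m)) = 0"
      using sum_cis_roots_of_unity_eq_0[OF nz[OF B]] N by (simp add: \<theta>_def)
  qed
  finally show ?thesis
    by (simp only: of_real_eq_0_iff)
qed

text \<open>The range of \<open>g\<close> is connected and misses 0, so all summands have the same
  sign.\<close>

lemma sum_nonzero_continuous_real_neq_0:
  fixes g :: "real \<Rightarrow> real"
  assumes g: "continuous_on UNIV g" and nz: "\<And>t. g t \<noteq> 0"
    and X: "finite X" "X \<noteq> {}"
  shows "(\<Sum>x\<in>X. g (h x)) \<noteq> 0"
proof -
  have "connected (range g)"
    using g by (intro connected_continuous_image) auto
  then have "(\<forall>t. g t > 0) \<or> (\<forall>t. g t < 0)"
    using connectedD_interval[of "range g" "g s" "g t" 0 for s t] nz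
    by (metis linorder_neqE_linordered_idom order_less_imp_le rangeE rangeI)
  then show ?thesis
  proof
    assume "\<forall>t. g t > 0"
    then show ?thesis using sum_pos[OF X, of "\<lambda>x. g (h x)"] by simp
  next
    assume "\<forall>t. g t < 0"
    then show ?thesis using sum_pos[OF X, of "\<lambda>x. - g (h x)"] by (simp add: sum_negf)
  qed
qed

lemma diag_pow_mult_vec_nth: "(diag_pow z k *v v) $ i = z powi (k $ i) * v $ i"
  by (simp add: diag_pow_def matrix_vector_mult_def if_distrib if_distribR cong: if_cong)

lemma subspace_indexed_basis:
  fixes V :: "'a::euclidean_space set"
  assumes "dim V = CARD('n::finite)"
  obtains b :: "'n::finite \<Rightarrow> 'a" where "range b \<subseteq> V" "inj b" "independent (range b)"
proof -
  obtain B where B: "B \<subseteq> V" "independent B" "card B = dim V"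
    by (rule basis_exists) auto
  have "finite B" using B(2) by (rule independent_imp_finite)
  then obtain b :: "'n \<Rightarrow> 'a" where "bij_betw b UNIV B"
    using finite_same_card_bij[of "UNIV :: 'n set" B] B(3) assms by auto
  then show thesis using that[of b] B by (auto simp: bij_betw_def)
qed

text \<open>A kernel vector of the matrix holds the coefficients of some \<open>v\<close> in
  \<open>V\<close> that the diagonal matrix sends to a real point. Goodness makes this point
  0.\<close>

lemma good_subspace_det_nonzero:
  fixes k :: "int ^ 'n" and b :: "'n \<Rightarrow> complex ^ 'n"
  assumes V: "good_subspace k V" and b: "range b \<subseteq> V" "inj b" "independent (range b)"
  shows "det (\<chi> i j. Im (cis (of_int (k $ i) * t) * b j $ i)) \<noteq> 0"
proof
  let ?A = "\<chi> i j. Im (cis (of_int (k $ i) * t) * b j $ i)"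
  assume "det ?A = 0"
  then have "\<not> invertible ?A"
    by (simp only: invertible_det_nz)
  then obtain x where x: "x \<noteq> 0" "?A *v x = 0"
    unfolding invertible_left_inverse matrix_left_invertible_ker by blast
  define v where "v = (\<Sum>j\<in>UNIV. x $ j *\<^sub>R b j)"
  have "v \<in> V"
    using V b(1) unfolding v_def good_subspace_def
    by (intro subspace_sum subspace_scale) auto
  have nth: "(diag_pow (cis t) k *v v) $ i =
      (\<Sum>j\<in>UNIV. x $ j *\<^sub>R (cis (of_int (k $ i) * t) * b j $ i))" for i
    by (simp add: diag_pow_mult_vec_nth cis_power_int v_def sum_distrib_left)
  have "Im ((diag_pow (cis t) k *v v) $ i) = (?A *v x) $ i" for i
    by (simp only: nth) (simp add: matrix_vector_mult_def mult.commute)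
  then have "diag_pow (cis t) k *v v \<in> real_points"
    unfolding x(2) real_points_def complex_is_Real_iff by simp
  with V \<open>v \<in> V\<close> have "diag_pow (cis t) k *v v = 0"
    unfolding good_subspace_def by (metis IntI imageI norm_cis singletonD)
  \<comment> \<open>The diagonal entries are powers of \<open>cis t\<close>, hence nonzero.\<close>
  then have "v = 0"
    by (simp add: vec_eq_iff diag_pow_mult_vec_nth)
  \<comment> \<open>\<open>independent_explicit\<close> takes coefficients indexed by the vectors
    themselves; injectivity of \<open>b\<close> allows this reindexing.\<close>
  then have "(\<Sum>u\<in>range b. x $ inv b u *\<^sub>R u) = 0"
    using b(2) by (simp add: sum.reindex v_def)
  then have "x $ inv b (b j) = 0" for j
    using b(3) unfolding independent_explicit
    by (auto dest!: spec[of _ "\<lambda>u. x $ inv b u"])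
  then show False
    using x(1) b(2) by (simp add: vec_eq_iff)
qed

theorem proposition6p5:
  fixes k :: "int ^ 'n"
  assumes "\<forall>j. k $ j \<noteq> 0"
    and "R_admissible k"
  shows "\<exists>\<kappa> :: int ^ 'n. (\<forall>j. \<kappa> $ j \<in> {1, -1}) \<and> (\<Sum>j\<in>UNIV. \<kappa> $ j * k $ j) = 0"
proof (rule ccontr)
  assume no_relation: "\<not> ?thesis"
  obtain V where V: "good_subspace k V"
    using assms(2) by (auto simp: R_admissible_def)
  then have "dim V = CARD('n)"
    by (simp add: good_subspace_def)
  then obtain b :: "'n \<Rightarrow> complex ^ 'n"
    where b: "range b \<subseteq> V" "inj b" "independent (range b)"
    by (rule subspace_indexed_basis)
  define g where "g t = det (\<chi> i j. Im (cis (of_int (k $ i) * t) * b j $ i))" for t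
  \<comment> \<open>Large enough to exceed the absolute value of every signed sum of the entries of
    \<open>k\<close>.\<close>
  define N where "N = nat (1 + (\<Sum>i\<in>UNIV. \<bar>k $ i\<bar>))"
  have N: "(\<Sum>i\<in>UNIV. \<bar>k $ i\<bar>) < int N"
    by (simp add: N_def)
  have "0 \<le> (\<Sum>i\<in>UNIV. \<bar>k $ i\<bar>)"
    by (simp add: sum_nonneg)
  with N have "N > 0" by linarith
  \<comment> \<open>A subset \<open>B\<close> encodes the choice of signs that is 1 on
    \<open>B\<close> and -1 elsewhere.\<close>
  have nz: "sum (($) k) B - sum (($) k) (UNIV - B) \<noteq> 0" for B
  proof
    assume eq: "sum (($) k) B - sum (($) k) (UNIV - B) = 0"
    let ?\<kappa> = "(\<chi> j. if j \<in> B then 1 else -1) :: int ^ 'n"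
    have "(\<Sum>j\<in>UNIV. ?\<kappa> $ j * k $ j) =
        (\<Sum>j\<in>UNIV - B. ?\<kappa> $ j * k $ j) + (\<Sum>j\<in>B. ?\<kappa> $ j * k $ j)"
      by (rule sum.subset_diff) auto
    also have "\<dots> = 0"
      using eq by (simp add: sum_negf)
    finally show False
      using no_relation by (auto dest!: spec[of _ ?\<kappa>] split: if_splits)
  qed
  have "continuous_on UNIV g"
    unfolding g_def det_def by (auto intro!: continuous_intros)
  then have "(\<Sum>m<N. g (2 * pi * real m / real N)) \<noteq> 0"
    using good_subspace_det_nonzero[OF V b] \<open>N > 0\<close>
    by (intro sum_nonzero_continuous_real_neq_0) (auto simp: g_def)
  \<comment> \<open>By the Leibniz formula every permutation \<open>p\<close> picks one entry from
    each row. The frequency in row \<open>i\<close> is \<open>k $ i\<close> whatever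
    \<open>p\<close> is, so each inner sum vanishes separately.\<close>
  have "(\<Sum>m<N. g (2 * pi * real m / real N)) =
      (\<Sum>p | p permutes (UNIV :: 'n set). of_int (sign p) *
        (\<Sum>m<N. \<Prod>i\<in>UNIV. Im (cis (of_int (k $ i) * (2 * pi * real m / real N)) * b (p i) $ i)))"
    unfolding g_def det_def by (subst sum.swap) (simp add: sum_distrib_left)
  then have "(\<Sum>m<N. g (2 * pi * real m / real N)) = 0"
    using sum_prod_Im_cis_eq_0[of UNIV "($) k", OF _ nz N] by simp
  with \<open>(\<Sum>m<N. g (2 * pi * real m / real N)) \<noteq> 0\<close> show False
    by contradiction
qed

end
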